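(* Let $A$ be a normal ordered subgroupoid of an ordered groupoid $G$. Then $G/\!/A$ (the set of $\simeq_A$-classes, with the composition and partial order of $\simeq_A$-classes described in the context) is an ordered groupoid, and the quotient map $\varpi : G \to G/\!/A$, $g \mapsto [g]$, is a fibration of ordered groupoids.
   Context: Conventions: a groupoid $G$ is a small category in which every morphism is invertible, identified with its set of arrows under partial composition; $G_0\subseteq G$ is its set of identities. An arrow $g$ has domain $g\mathbf{d}=gg^{-1}$ and range $g\mathbf{r}=g^{-1}g$, and $gh$ is defined iff $g\mathbf{r}=h\mathbf{d}$. Maps are written on the right. For $e\in G_0$, $\mathrm{star}_G(e)=\{g\in G: g\mathbf{d}=e\}$. An ordered groupoid is a groupoid $G$ with a partial order $\leq$ on arrows such that: (OG1) $g\leq h$ implies $g^{-1}\leq h^{-1}$; (OG2) if $g_1\leq g_2$, $h_1\leq h_2$ and $g_1h_1$, $g_2h_2$ are defined, then $g_1h_1\leq g_2h_2$; (OG3) if $g\in G$, $f\in G_0$ and $f\leq g\mathbf{d}$, there is a unique element $(f|g)$ (the restriction of $g$ to $f$) with $(f|g)\mathbf{d}=f$ and $(f|g)\leq g$. If $f\in G_0$ and $f\leq g\mathbf{r}$, the corestriction is $(g|f)=(f|g^{-1})^{-1}$, the unique element below $g$ with range $f$. An ordered functor is an order-preserving functor between ordered groupoids. A fibration of ordered groupoids is an ordered functor $p:G\to H$ that is star-surjective: for each $e\in G_0$ the restriction $\mathrm{star}_G(e)\to \mathrm{star}_H(ep)$ is surjective. A normal ordered subgroupoid of $G$ is a subgroupoid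 $A$ such that: $A_0=G_0$; if $a\in A$ and $e\in G_0$ with $e\leq aa^{-1}$ then $(e|a)\in A$; and if $a\in A$ and $h,k\in G$ are such that $h\leq g$, $k\leq g$ for some $g\in G$ and $h^{-1}ak$ is defined in $G$, then $h^{-1}ak\in A$. The relation $\simeq_A$ on $G$: $g\simeq_A h$ iff there exist $a,b,c,d\in A$ such that $agb\leq h$ and $chd\leq g$ (the products being defined). It is an equivalence relation; $[g]$ denotes the class of $g$ and $G/\!/A$ the set of classes. Order: $[g]\leq[k]$ iff there exist $a,b\in A$ with $agb\leq k$. For $e,f\in G_0$ an $A$-nexus between $e$ and $f$ is a pair $(a,p)$ of arrows of $A$ with $aa^{-1}\leq e$, $a^{-1}a=f$, $pp^{-1}\leq f$, $p^{-1}p=e$; one has $e\simeq_A f$ iff such a nexus exists. Composition: $[g][h]$ is defined iff $g^{-1}g\simeq_A hh^{-1}$, and then $[g][h]=[g'ah]$, where $(a,p)$ is any $A$-nexus between $g^{-1}g$ and $hh^{-1}$ and $g'=(g|aa^{-1})$ (this class does not depend on the choices). *)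

theory Defs
  imports Main
begin

record 'a ogpd =
  arrows :: "'a set"
  pcomp :: "'a \<Rightarrow> 'a \<Rightarrow> 'a option"  (infixl "\<cdot>\<index>" 70)
  le :: "'a \<Rightarrow> 'a \<Rightarrow> bool"  (infix "\<sqsubseteq>\<index>" 50)

text \<open>Composition is in diagrammatic order, and \<open>g \<cdot> h = None\<close> means that the product is undefined.\<close>

definition pcomp3 :: "('a, 'm) ogpd_scheme \<Rightarrow> 'a \<Rightarrow> 'a \<Rightarrow> 'a \<Rightarrow> 'a option" where
  "pcomp3 G x y z = Option.bind (pcomp G x y) (\<lambda>u. pcomp G u z)"

definition identities :: "('a, 'm) ogpd_scheme \<Rightarrow> 'a set" where
  "identities G = {e \<in> arrows G. \<forall>g. (pcomp G e g \<noteq> None \<longrightarrow> pcomp G e g = Some g) \<and>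
                                     (pcomp G g e \<noteq> None \<longrightarrow> pcomp G g e = Some g)}"

text \<open>The arrows-only axioms of a category (objects are identified with identity arrows), together
  with invertibility. Equality of the two options in \<open>assoc\<close> says that one of the two bracketings is
  defined iff the other is, and that then they agree.\<close>

locale groupoid =
  fixes G :: "('a, 'm) ogpd_scheme" (structure)
  assumes comp_arrows: "g \<cdot> h = Some k \<Longrightarrow> g \<in> arrows G \<and> h \<in> arrows G \<and> k \<in> arrows G"
    and assoc: "Option.bind (g \<cdot> h) (\<lambda>x. x \<cdot> k) = Option.bind (h \<cdot> k) (\<lambda>y. g \<cdot> y)"
    and comp_defined: "g \<cdot> h \<noteq> None \<Longrightarrow> h \<cdot> k \<noteq> None \<Longrightarrow> pcomp3 G g h k \<noteq> None"
    and left_identity: "g \<in> arrows G \<Longrightarrow> \<exists>e \<in> identities G. e \<cdot> g \<noteq> None"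
    and right_identity: "g \<in> arrows G \<Longrightarrow> \<exists>f \<in> identities G. g \<cdot> f \<noteq> None"
    and invertible: "g \<in> arrows G \<Longrightarrow>
      \<exists>h \<in> arrows G. \<exists>e \<in> identities G. \<exists>f \<in> identities G. g \<cdot> h = Some e \<and> h \<cdot> g = Some f"

definition ginv :: "('a, 'm) ogpd_scheme \<Rightarrow> 'a \<Rightarrow> 'a" where
  "ginv G g = (THE h. \<exists>e \<in> identities G. \<exists>f \<in> identities G. pcomp G g h = Some e \<and> pcomp G h g = Some f)"

definition gdom :: "('a, 'm) ogpd_scheme \<Rightarrow> 'a \<Rightarrow> 'a" where
  "gdom G g = the (pcomp G g (ginv G g))"

definition gran :: "('a, 'm) ogpd_scheme \<Rightarrow> 'a \<Rightarrow> 'a" where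
  "gran G g = the (pcomp G (ginv G g) g)"

definition star :: "('a, 'm) ogpd_scheme \<Rightarrow> 'a \<Rightarrow> 'a set" where
  "star G e = {g \<in> arrows G. gdom G g = e}"

locale ordered_groupoid = groupoid +
  assumes partial_order: "partial_order_on (arrows G) {(g, h). g \<sqsubseteq> h}"
    and OG1: "g \<sqsubseteq> h \<Longrightarrow> ginv G g \<sqsubseteq> ginv G h"
    and OG2: "\<lbrakk>g\<^sub>1 \<sqsubseteq> g\<^sub>2; h\<^sub>1 \<sqsubseteq> h\<^sub>2; g\<^sub>1 \<cdot> h\<^sub>1 = Some k\<^sub>1; g\<^sub>2 \<cdot> h\<^sub>2 = Some k\<^sub>2\<rbrakk> \<Longrightarrow> k\<^sub>1 \<sqsubseteq> k\<^sub>2"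
    and OG3: "\<lbrakk>g \<in> arrows G; f \<in> identities G; f \<sqsubseteq> gdom G g\<rbrakk> \<Longrightarrow>
      \<exists>!x. x \<in> arrows G \<and> gdom G x = f \<and> x \<sqsubseteq> g"

definition restriction :: "('a, 'm) ogpd_scheme \<Rightarrow> 'a \<Rightarrow> 'a \<Rightarrow> 'a" where
  "restriction G f g = (THE x. x \<in> arrows G \<and> gdom G x = f \<and> le G x g)"

definition corestriction :: "('a, 'm) ogpd_scheme \<Rightarrow> 'a \<Rightarrow> 'a \<Rightarrow> 'a" where
  "corestriction G g f = ginv G (restriction G f (ginv G g))"

locale ordered_functor = source: ordered_groupoid G + target: ordered_groupoid H
  for G :: "('a, 'm) ogpd_scheme" and H :: "('b, 'n) ogpd_scheme" and p :: "'a \<Rightarrow> 'b" +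
  assumes map_arrows: "g \<in> arrows G \<Longrightarrow> p g \<in> arrows H"
    and map_identities: "e \<in> identities G \<Longrightarrow> p e \<in> identities H"
    and map_comp: "pcomp G g h = Some k \<Longrightarrow> pcomp H (p g) (p h) = Some (p k)"
    and map_le: "le G g h \<Longrightarrow> le H (p g) (p h)"

locale fibration = ordered_functor +
  assumes star_surjective: "e \<in> identities G \<Longrightarrow> p ` star G e = star H (p e)"

definition subgroupoid :: "'a set \<Rightarrow> ('a, 'm) ogpd_scheme \<Rightarrow> bool" where
  "subgroupoid A G \<longleftrightarrow> A \<subseteq> arrows G \<and>
     (\<forall>a \<in> A. \<forall>b \<in> A. \<forall>c. pcomp G a b = Some c \<longrightarrow> c \<in> A) \<and>
     (\<forall>a \<in> A. ginv G a \<in> A)"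

definition normal_ordered_subgroupoid :: "'a set \<Rightarrow> ('a, 'm) ogpd_scheme \<Rightarrow> bool" where
  "normal_ordered_subgroupoid A G \<longleftrightarrow> subgroupoid A G \<and>
     A \<inter> identities G = identities G \<and>
     (\<forall>a \<in> A. \<forall>e \<in> identities G. le G e (gdom G a) \<longrightarrow> restriction G e a \<in> A) \<and>
     (\<forall>a \<in> A. \<forall>g h k x. le G h g \<and> le G k g \<and> pcomp3 G (ginv G h) a k = Some x \<longrightarrow> x \<in> A)"

definition below_mod :: "('a, 'm) ogpd_scheme \<Rightarrow> 'a set \<Rightarrow> 'a \<Rightarrow> 'a \<Rightarrow> bool" where
  "below_mod G A g k \<longleftrightarrow> (\<exists>a \<in> A. \<exists>b \<in> A. \<exists>x. pcomp3 G a g b = Some x \<and> le G x k)"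

definition sim :: "('a, 'm) ogpd_scheme \<Rightarrow> 'a set \<Rightarrow> ('a \<times> 'a) set" where
  "sim G A = {(g, h). g \<in> arrows G \<and> h \<in> arrows G \<and> below_mod G A g h \<and> below_mod G A h g}"

definition nexus :: "('a, 'm) ogpd_scheme \<Rightarrow> 'a set \<Rightarrow> 'a \<Rightarrow> 'a \<Rightarrow> 'a \<Rightarrow> 'a \<Rightarrow> bool" where
  "nexus G A e f a p \<longleftrightarrow> a \<in> A \<and> p \<in> A \<and>
     le G (gdom G a) e \<and> gran G a = f \<and> le G (gdom G p) f \<and> gran G p = e"

definition quotient_map :: "('a, 'm) ogpd_scheme \<Rightarrow> 'a set \<Rightarrow> 'a \<Rightarrow> 'a set" where
  "quotient_map G A g = sim G A `` {g}"

text \<open>The description \<open>THE Z\<close> ranges over all representatives and all nexuses, so that it denotes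
  something meaningful only because the resulting class does not depend on any of these choices.\<close>

definition quotient_comp :: "('a, 'm) ogpd_scheme \<Rightarrow> 'a set \<Rightarrow> 'a set \<Rightarrow> 'a set \<Rightarrow> 'a set option" where
  "quotient_comp G A X Y =
     (if X \<in> arrows G // sim G A \<and> Y \<in> arrows G // sim G A \<and>
         (\<exists>g \<in> X. \<exists>h \<in> Y. (gran G g, gdom G h) \<in> sim G A)
      then Some (THE Z. \<exists>g \<in> X. \<exists>h \<in> Y. \<exists>a p x. nexus G A (gran G g) (gdom G h) a p \<and>
             pcomp3 G (corestriction G g (gdom G a)) a h = Some x \<and> Z = quotient_map G A x)
      else None)"

definition quotient_groupoid :: "('a, 'm) ogpd_scheme \<Rightarrow> 'a set \<Rightarrow> 'a set ogpd" where
  "quotient_groupoid G A =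
     \<lparr>arrows = arrows G // sim G A,
      pcomp = quotient_comp G A,
      le = (\<lambda>X Y. X \<in> arrows G // sim G A \<and> Y \<in> arrows G // sim G A \<and>
                   (\<exists>g \<in> X. \<exists>k \<in> Y. below_mod G A g k))\<rparr>"

end

theory Submission
  imports Defs
begin

text \<open>
  Write \<open>g \<lesssim> h\<close> if some product \<open>a g b\<close> with \<open>a\<close>, \<open>b\<close> in \<open>A\<close> lies below \<open>h\<close>. Restricting the arrows
  of \<open>A\<close> shows that this is a preorder, and \<open>\<simeq>\<close> is its kernel, so the classes are partially ordered
  for free. What needs the normality of \<open>A\<close> is that products and restrictions of classes are well
  defined, and in both cases normality enters through the same observation. If \<open>h\<close> and \<open>k\<close> lie
  below a common arrow and \<open>a\<close> in \<open>A\<close> runs from the domain of \<open>h\<close> to the domain of \<open>k\<close>, then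
  \<open>v = h\<^sup>-\<^sup>1 a k\<close> is in \<open>A\<close>, so that \<open>a k = h v\<close>: an arrow of \<open>A\<close> can be moved from the left of \<open>k\<close> to
  the right of \<open>h\<close>.

  Moving an arrow of \<open>A\<close> across in this way gives two facts.
  \<^item> Two arrows below a common arrow are equivalent as soon as their domains are, or their ranges
    are (\<open>sim_if_gdom_sim\<close>, \<open>sim_if_gran_sim\<close>). This is the uniqueness of restrictions in the
    quotient. It also shows that \<open>g\<close> can be replaced within its class by an arrow with any
    prescribed range equivalent to the range of \<open>g\<close>, and likewise for domains (\<open>lift_gran\<close>,
    \<open>lift_gdom\<close>).
  \<^item> The product is monotone for \<open>\<lesssim>\<close> wherever it is defined (\<open>below_mul_mono\<close>). In particular the
    class of a product of composable arrows depends only on the classes of the factors.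

  Consequently the composition of classes, although described through nexuses, is the
  composition of composable representatives, and composable representatives exist whenever the
  end classes match (\<open>quotient_comp_cls\<close>, \<open>quotient_comp_SomeE\<close>). The axioms of an ordered
  groupoid then pass from \<open>G\<close> to the quotient by choosing representatives that fit together, and
  star-surjectivity of the quotient map is exactly the lifting of domains.
\<close>

section \<open>Arrow calculus in a groupoid\<close>

context groupoid
begin

text \<open>A total product, so that products can be rewritten as terms once their factors are known to be
  composable. It is kept opaque: unfolded, it would make \<open>g \<cdot> h = Some (g \<bullet> h)\<close> a looping rewrite rule.\<close>

definition mul (infixl "\<bullet>" 70) where
  "g \<bullet> h = the (g \<cdot> h)"

lemma identity_in_arrows: "e \<in> identities G \<Longrightarrow> e \<in> arrows G"
  by (simp add: identities_def)

lemma identity_left: "\<lbrakk>e \<in> identities G; e \<cdot> g = Some x\<rbrakk> \<Longrightarrow> x = g"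
  unfolding identities_def by (metis (mono_tags, lifting) mem_Collect_eq option.distinct(1) option.inject)

lemma identity_right: "\<lbrakk>e \<in> identities G; g \<cdot> e = Some x\<rbrakk> \<Longrightarrow> x = g"
  unfolding identities_def by (metis (mono_tags, lifting) mem_Collect_eq option.distinct(1) option.inject)

lemma identity_idem:
  assumes e: "e \<in> identities G"
  shows "e \<cdot> e = Some e"
proof -
  obtain e' x where e': "e' \<in> identities G" "e' \<cdot> e = Some x"
    using left_identity[OF identity_in_arrows[OF e]] by blast
  with e show ?thesis
    using identity_left[OF e'] identity_right[OF e e'(2)] by simp
qed

text \<open>As \<open>e (e' g) = e g\<close> is defined, so is \<open>e e'\<close>, and a product of two identities equals both factors.\<close>

lemma left_identity_unique:
  assumes "e \<in> identities G" "e' \<in> identities G" "e \<cdot> g = Some x" "e' \<cdot> g = Some y"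
  shows "e = e'"
proof -
  have "y = g" using identity_left assms by blast
  then have "Option.bind (e \<cdot> e') (\<lambda>z. z \<cdot> g) = Some x"
    using assms(3,4) assoc[of e e' g] by simp
  then obtain z where z: "e \<cdot> e' = Some z" by (cases "e \<cdot> e'") auto
  show ?thesis
    using identity_left[OF assms(1) z] identity_right[OF assms(2) z] by simp
qed

text \<open>The two category axioms on associativity combine into one statement about defined products,
  which is the form that every computation below uses.\<close>

lemma sandwich:
  assumes gh: "g \<cdot> h = Some x" and hk: "h \<cdot> k = Some y"
  shows "\<exists>z. x \<cdot> k = Some z \<and> g \<cdot> y = Some z"
proof -
  have "x \<cdot> k \<noteq> None" using comp_defined[of g h k] gh hk by (simp add: pcomp3_def)
  then show ?thesis using assoc[of g h k] gh hk by auto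
qed

lemma inverse_unique:
  assumes "g \<cdot> h = Some e" "h \<cdot> g = Some f" "g \<cdot> h' = Some e'" "h' \<cdot> g = Some f'"
    and ids: "e \<in> identities G" "f' \<in> identities G"
  shows "h = h'"
proof -
  obtain z where "f' \<cdot> h = Some z" "h' \<cdot> e = Some z"
    using sandwich[OF assms(4,1)] by blast
  then show ?thesis using identity_left identity_right ids by metis
qed

lemma ginv_eqI:
  assumes "g \<cdot> h = Some e" "h \<cdot> g = Some f" "e \<in> identities G" "f \<in> identities G"
  shows "ginv G g = h"
  unfolding ginv_def
proof (rule the_equality)
  show "\<exists>e\<in>identities G. \<exists>f\<in>identities G. g \<cdot> h = Some e \<and> h \<cdot> g = Some f"
    using assms by blast
qed (use assms inverse_unique in blast)

lemma gdom_eqI: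
  assumes "g \<cdot> h = Some e" "h \<cdot> g = Some f" "e \<in> identities G" "f \<in> identities G"
  shows "gdom G g = e"
  unfolding gdom_def ginv_eqI[OF assms] using assms by simp

lemma inverse_laws:
  assumes "g \<in> arrows G"
  shows "ginv G g \<in> arrows G" "gdom G g \<in> identities G" "gran G g \<in> identities G"
    and "g \<cdot> ginv G g = Some (gdom G g)" "ginv G g \<cdot> g = Some (gran G g)"
proof -
  obtain h e f where h: "h \<in> arrows G" "e \<in> identities G" "f \<in> identities G"
      "g \<cdot> h = Some e" "h \<cdot> g = Some f"
    using invertible[OF assms] by blast
  have eq: "ginv G g = h" using ginv_eqI h by blast
  then show "ginv G g \<in> arrows G" "gdom G g \<in> identities G" "gran G g \<in> identities G"
    "g \<cdot> ginv G g = Some (gdom G g)" "ginv G g \<cdot> g = Some (gran G g)"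
    using h by (simp_all add: gdom_def gran_def)
qed

lemma gdom_comp: "g \<in> arrows G \<Longrightarrow> gdom G g \<cdot> g = Some g"
  using sandwich[OF inverse_laws(4,5)] identity_left inverse_laws(2) by fast

lemma comp_gran: "g \<in> arrows G \<Longrightarrow> g \<cdot> gran G g = Some g"
  using sandwich[OF inverse_laws(4,5)] identity_right inverse_laws(3) by fast

text \<open>This turns the partial composition into one controlled by domains and ranges: \<open>g\<^sup>-\<^sup>1 g h\<close> is defined
  along with \<open>g h\<close>, so the range of \<open>g\<close> is a left identity of \<open>h\<close> and hence the domain of \<open>h\<close>.\<close>

lemma comp_defined_iff:
  "g \<cdot> h \<noteq> None \<longleftrightarrow> g \<in> arrows G \<and> h \<in> arrows G \<and> gran G g = gdom G h"
proof
  assume "g \<cdot> h \<noteq> None"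
  then obtain x where x: "g \<cdot> h = Some x" by blast
  then have arr: "g \<in> arrows G" "h \<in> arrows G" using comp_arrows by blast+
  obtain z where "gran G g \<cdot> h = Some z"
    using sandwich[OF inverse_laws(5)[OF arr(1)] x] by blast
  then have "gran G g = gdom G h"
    using left_identity_unique gdom_comp inverse_laws arr by metis
  with arr show "g \<in> arrows G \<and> h \<in> arrows G \<and> gran G g = gdom G h" by blast
next
  assume a: "g \<in> arrows G \<and> h \<in> arrows G \<and> gran G g = gdom G h"
  then have "g \<cdot> gran G g = Some g" "gran G g \<cdot> h = Some h"
    using comp_gran[of g] gdom_comp[of h] by simp_all
  then show "g \<cdot> h \<noteq> None" using sandwich by blast
qed

lemma comp_Some_iff:
  "g \<cdot> h = Some x \<longleftrightarrow>
     g \<in> arrows G \<and> h \<in> arrows G \<and> gran G g = gdom G h \<and> x = g \<bullet> h"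
  using comp_defined_iff[of g h] by (cases "g \<cdot> h") (auto simp: mul_def)

lemma ginv_arrow [simp]: "g \<in> arrows G \<Longrightarrow> ginv G g \<in> arrows G"
  by (rule inverse_laws)

lemma gdom_identity [simp]: "g \<in> arrows G \<Longrightarrow> gdom G g \<in> identities G"
  by (rule inverse_laws)

lemma gran_identity [simp]: "g \<in> arrows G \<Longrightarrow> gran G g \<in> identities G"
  by (rule inverse_laws)

lemma gdom_arrow [simp]: "g \<in> arrows G \<Longrightarrow> gdom G g \<in> arrows G"
  by (simp add: identity_in_arrows)

lemma gran_arrow [simp]: "g \<in> arrows G \<Longrightarrow> gran G g \<in> arrows G"
  by (simp add: identity_in_arrows)

lemma ginv_of_identity: "e \<in> identities G \<Longrightarrow> ginv G e = e"
  using ginv_eqI identity_idem by blast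

lemma gdom_of_identity [simp]: "e \<in> identities G \<Longrightarrow> gdom G e = e"
  using ginv_of_identity identity_idem by (simp add: gdom_def)

lemma gran_of_identity [simp]: "e \<in> identities G \<Longrightarrow> gran G e = e"
  using ginv_of_identity identity_idem by (simp add: gran_def)

lemma ginv_ginv [simp]: "g \<in> arrows G \<Longrightarrow> ginv G (ginv G g) = g"
  by (rule ginv_eqI) (rule inverse_laws; assumption)+

lemma gdom_ginv [simp]: "g \<in> arrows G \<Longrightarrow> gdom G (ginv G g) = gran G g"
  by (simp add: gdom_def gran_def)

lemma gran_ginv [simp]: "g \<in> arrows G \<Longrightarrow> gran G (ginv G g) = gdom G g"
  by (simp add: gdom_def gran_def)

lemma gdom_mul_self [simp]: "g \<in> arrows G \<Longrightarrow> gdom G g \<bullet> g = g"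
  by (simp add: gdom_comp mul_def)

lemma mul_gran_self [simp]: "g \<in> arrows G \<Longrightarrow> g \<bullet> gran G g = g"
  by (simp add: comp_gran mul_def)

lemma mul_ginv [simp]: "g \<in> arrows G \<Longrightarrow> g \<bullet> ginv G g = gdom G g"
  by (simp add: inverse_laws mul_def)

lemma ginv_mul [simp]: "g \<in> arrows G \<Longrightarrow> ginv G g \<bullet> g = gran G g"
  by (simp add: inverse_laws mul_def)

lemma mul_arrow [simp]:
  "\<lbrakk>g \<in> arrows G; h \<in> arrows G; gran G g = gdom G h\<rbrakk> \<Longrightarrow> g \<bullet> h \<in> arrows G"
  using comp_Some_iff comp_arrows by blast

lemma gdom_mul [simp]:
  assumes "g \<in> arrows G" "h \<in> arrows G" "gran G g = gdom G h"
  shows "gdom G (g \<bullet> h) = gdom G g"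
proof -
  have "g \<cdot> h = Some (g \<bullet> h)" using comp_Some_iff assms by blast
  then obtain z where "gdom G g \<cdot> (g \<bullet> h) = Some z"
    using sandwich gdom_comp assms(1) by blast
  then show ?thesis using assms by (simp add: comp_Some_iff)
qed

lemma gran_mul [simp]:
  assumes "g \<in> arrows G" "h \<in> arrows G" "gran G g = gdom G h"
  shows "gran G (g \<bullet> h) = gran G h"
proof -
  have "g \<cdot> h = Some (g \<bullet> h)" using comp_Some_iff assms by blast
  then obtain z where "(g \<bullet> h) \<cdot> gran G h = Some z"
    using sandwich comp_gran assms(2) by blast
  then show ?thesis using assms by (simp add: comp_Some_iff)
qed

lemma mul_assoc [simp]:
  assumes "g \<in> arrows G" "h \<in> arrows G" "k \<in> arrows G" "gran G g = gdom G h" "gran G h = gdom G k"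
  shows "(g \<bullet> h) \<bullet> k = g \<bullet> (h \<bullet> k)"
proof -
  have "g \<cdot> h = Some (g \<bullet> h)" "h \<cdot> k = Some (h \<bullet> k)" using comp_Some_iff assms by blast+
  from sandwich[OF this] show ?thesis by (auto simp: comp_Some_iff)
qed

lemma ginv_mul_cancel [simp]:
  assumes "g \<in> arrows G" "h \<in> arrows G" "gran G g = gdom G h"
  shows "ginv G g \<bullet> (g \<bullet> h) = h"
  using mul_assoc[of "ginv G g" g h] assms by simp

lemma mul_ginv_cancel [simp]:
  assumes "g \<in> arrows G" "h \<in> arrows G" "gdom G g = gdom G h"
  shows "g \<bullet> (ginv G g \<bullet> h) = h"
  using mul_assoc[of g "ginv G g" h] assms by simp

lemma ginv_of_mul [simp]:
  assumes "g \<in> arrows G" "h \<in> arrows G" "gran G g = gdom G h"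
  shows "ginv G (g \<bullet> h) = ginv G h \<bullet> ginv G g"
proof (rule ginv_eqI)
  show "(g \<bullet> h) \<cdot> (ginv G h \<bullet> ginv G g) = Some (gdom G g)"
    using assms by (simp add: comp_Some_iff)
  show "(ginv G h \<bullet> ginv G g) \<cdot> (g \<bullet> h) = Some (gran G h)"
    using assms by (simp add: comp_Some_iff)
qed (use assms in simp_all)

lemma pcomp3_Some_iff:
  "pcomp3 G x y z = Some w \<longleftrightarrow> x \<in> arrows G \<and> y \<in> arrows G \<and> z \<in> arrows G \<and>
     gran G x = gdom G y \<and> gran G y = gdom G z \<and> w = x \<bullet> (y \<bullet> z)"
proof
  assume "pcomp3 G x y z = Some w"
  then obtain u where "x \<cdot> y = Some u" "u \<cdot> z = Some w"
    by (auto simp: pcomp3_def bind_eq_Some_conv)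
  then show "x \<in> arrows G \<and> y \<in> arrows G \<and> z \<in> arrows G \<and>
     gran G x = gdom G y \<and> gran G y = gdom G z \<and> w = x \<bullet> (y \<bullet> z)"
    by (auto simp: comp_Some_iff)
next
  assume r: "x \<in> arrows G \<and> y \<in> arrows G \<and> z \<in> arrows G \<and>
     gran G x = gdom G y \<and> gran G y = gdom G z \<and> w = x \<bullet> (y \<bullet> z)"
  then have "x \<cdot> y = Some (x \<bullet> y)" "(x \<bullet> y) \<cdot> z = Some w"
    unfolding comp_Some_iff by simp_all
  then show "pcomp3 G x y z = Some w" by (simp add: pcomp3_def)
qed

end


section \<open>Order and restriction\<close>

context ordered_groupoid
begin

lemma le_arrows: "g \<sqsubseteq> h \<Longrightarrow> g \<in> arrows G \<and> h \<in> arrows G"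
  using partial_order unfolding partial_order_on_def preorder_on_def by blast

lemma le_refl: "g \<in> arrows G \<Longrightarrow> g \<sqsubseteq> g"
  using partial_order unfolding partial_order_on_def preorder_on_def refl_on_def by blast

lemma le_trans: "g \<sqsubseteq> h \<Longrightarrow> h \<sqsubseteq> k \<Longrightarrow> g \<sqsubseteq> k"
  using partial_order unfolding partial_order_on_def preorder_on_def trans_def by blast

lemma mul_mono:
  assumes "g \<sqsubseteq> g'" "h \<sqsubseteq> h'" "gran G g = gdom G h" "gran G g' = gdom G h'"
  shows "g \<bullet> h \<sqsubseteq> g' \<bullet> h'"
  using OG2[OF assms(1,2)] assms le_arrows comp_Some_iff by blast

lemma gdom_mono: "g \<sqsubseteq> h \<Longrightarrow> gdom G g \<sqsubseteq> gdom G h"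
  using mul_mono[OF _ OG1, of g h g h] le_arrows[of g h] by simp

lemma gran_mono: "g \<sqsubseteq> h \<Longrightarrow> gran G g \<sqsubseteq> gran G h"
  using mul_mono[OF OG1, of g h g h] le_arrows[of g h] by simp

lemma restriction:
  assumes "g \<in> arrows G" "f \<in> identities G" "f \<sqsubseteq> gdom G g"
  shows "restriction G f g \<in> arrows G" "gdom G (restriction G f g) = f" "restriction G f g \<sqsubseteq> g"
  using theI'[OF OG3[OF assms]] unfolding restriction_def by auto

lemma corestriction:
  assumes "g \<in> arrows G" "f \<in> identities G" "f \<sqsubseteq> gran G g"
  shows "corestriction G g f \<in> arrows G" "gran G (corestriction G g f) = f"
    "corestriction G g f \<sqsubseteq> g"
proof -
  have f: "f \<sqsubseteq> gdom G (ginv G g)" using assms by simp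
  note r = restriction[OF ginv_arrow[OF assms(1)] assms(2) f]
  show "corestriction G g f \<in> arrows G" "gran G (corestriction G g f) = f"
    using r by (simp_all add: corestriction_def)
  show "corestriction G g f \<sqsubseteq> g"
    using OG1[OF r(3)] assms(1) by (simp add: corestriction_def)
qed

end


section \<open>The preorder modulo a normal ordered subgroupoid\<close>

locale normal_quotient = ordered_groupoid G
  for G :: "('a, 'm) ogpd_scheme" (structure) +
  fixes A :: "'a set"
  assumes normal: "normal_ordered_subgroupoid A G"
begin

abbreviation below (infix "\<lesssim>" 50) where "g \<lesssim> h \<equiv> below_mod G A g h"
abbreviation equivalent (infix "\<simeq>" 50) where "g \<simeq> h \<equiv> (g, h) \<in> sim G A"
abbreviation cls where "cls \<equiv> quotient_map G A"

lemma normal_props: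
  shows "A \<subseteq> arrows G"
    and "\<lbrakk>a \<in> A; b \<in> A; a \<cdot> b = Some c\<rbrakk> \<Longrightarrow> c \<in> A"
    and "a \<in> A \<Longrightarrow> ginv G a \<in> A"
    and "identities G \<subseteq> A"
    and "\<lbrakk>a \<in> A; e \<in> identities G; e \<sqsubseteq> gdom G a\<rbrakk> \<Longrightarrow> restriction G e a \<in> A"
    and "\<lbrakk>a \<in> A; h \<sqsubseteq> g; k \<sqsubseteq> g; pcomp3 G (ginv G h) a k = Some x\<rbrakk> \<Longrightarrow> x \<in> A"
  using normal unfolding normal_ordered_subgroupoid_def subgroupoid_def by blast+

lemma A_arrow [simp]: "a \<in> A \<Longrightarrow> a \<in> arrows G"
  using normal_props(1) by blast

lemma A_identity [simp]: "e \<in> identities G \<Longrightarrow> e \<in> A"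
  using normal_props(4) by blast

lemma A_mul [simp]: "\<lbrakk>a \<in> A; b \<in> A; gran G a = gdom G b\<rbrakk> \<Longrightarrow> a \<bullet> b \<in> A"
  using normal_props(2) comp_Some_iff A_arrow by blast

lemma A_ginv [simp]: "a \<in> A \<Longrightarrow> ginv G a \<in> A"
  by (rule normal_props(3))

lemmas A_restriction = normal_props(5)

lemma A_corestriction: "\<lbrakk>a \<in> A; e \<in> identities G; e \<sqsubseteq> gran G a\<rbrakk> \<Longrightarrow> corestriction G a e \<in> A"
  by (simp add: corestriction_def A_restriction)

text \<open>The third condition on a normal ordered subgroupoid, in terms of domains and ranges. It is the
  only place where normality, as opposed to closure under restriction, is used.\<close>

lemma A_conjugate:
  assumes "a \<in> A" "h \<sqsubseteq> g" "k \<sqsubseteq> g" "gdom G h = gdom G a" "gran G a = gdom G k"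
  shows "ginv G h \<bullet> (a \<bullet> k) \<in> A"
proof -
  have "pcomp3 G (ginv G h) a k = Some (ginv G h \<bullet> (a \<bullet> k))"
    using assms le_arrows by (simp add: pcomp3_Some_iff)
  then show ?thesis by (rule normal_props(6)[OF assms(1-3)])
qed

lemma belowI:
  assumes "a \<in> A" "b \<in> A" "g \<in> arrows G" "gran G a = gdom G g" "gran G g = gdom G b"
    and "a \<bullet> (g \<bullet> b) \<sqsubseteq> k"
  shows "g \<lesssim> k"
  using assms A_arrow unfolding below_mod_def pcomp3_Some_iff by blast

lemma belowE:
  assumes "g \<lesssim> k"
  obtains a b where "a \<in> A" "b \<in> A" "g \<in> arrows G" "k \<in> arrows G"
    "gran G a = gdom G g" "gran G g = gdom G b" "a \<bullet> (g \<bullet> b) \<sqsubseteq> k"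
  using assms le_arrows unfolding below_mod_def pcomp3_Some_iff by blast

lemma below_arrows: "g \<lesssim> h \<Longrightarrow> g \<in> arrows G \<and> h \<in> arrows G"
  by (erule belowE) blast

lemma below_if_le: "g \<sqsubseteq> h \<Longrightarrow> g \<lesssim> h"
  using le_arrows[of g h] belowI[of "gdom G g" "gran G g" g h] by simp

lemma below_refl: "g \<in> arrows G \<Longrightarrow> g \<lesssim> g"
  using below_if_le le_refl by blast

text \<open>If \<open>a g b \<le> h\<close> and \<open>c h d \<le> k\<close>, the factors \<open>c\<close> and \<open>d\<close> need not compose with \<open>a\<close> and \<open>b\<close>, but their
  restrictions to the ends of \<open>a g b\<close> do, and these stay in \<open>A\<close>.\<close>

lemma below_trans:
  assumes "g \<lesssim> h" "h \<lesssim> k"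
  shows "g \<lesssim> k"
proof -
  obtain a b where ab: "a \<in> A" "b \<in> A" "g \<in> arrows G" "h \<in> arrows G"
    "gran G a = gdom G g" "gran G g = gdom G b" "a \<bullet> (g \<bullet> b) \<sqsubseteq> h"
    using assms(1) by (rule belowE)
  obtain c d where cd: "c \<in> A" "d \<in> A" "k \<in> arrows G"
    "gran G c = gdom G h" "gran G h = gdom G d" "c \<bullet> (h \<bullet> d) \<sqsubseteq> k"
    using assms(2) by (rule belowE)
  define x where "x = a \<bullet> (g \<bullet> b)"
  have x: "x \<in> arrows G" "gdom G x = gdom G a" "gran G x = gran G b" "x \<sqsubseteq> h"
    using ab by (simp_all add: x_def)
  (* The outer factors are cut down to the ends of x, so that they compose with a and b in A. *)
  define c' where "c' = corestriction G c (gdom G x)"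
  define d' where "d' = restriction G (gran G x) d"
  have le: "gdom G x \<sqsubseteq> gran G c" "gran G x \<sqsubseteq> gdom G d"
    using gdom_mono[OF x(4)] gran_mono[OF x(4)] cd by simp_all
  have c': "c' \<in> A" "gran G c' = gdom G x" "c' \<sqsubseteq> c"
    using A_corestriction corestriction le cd(1) x(1) unfolding c'_def by simp_all
  have d': "d' \<in> A" "gdom G d' = gran G x" "d' \<sqsubseteq> d"
    using A_restriction restriction le cd(2) x(1) unfolding d'_def by simp_all
  have "x \<bullet> d' \<sqsubseteq> h \<bullet> d"
    using mul_mono x d' cd by simp
  then have "c' \<bullet> (x \<bullet> d') \<sqsubseteq> c \<bullet> (h \<bullet> d)"
    using mul_mono x c' d' cd ab by simp
  then have "(c' \<bullet> a) \<bullet> (g \<bullet> (b \<bullet> d')) \<sqsubseteq> k"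
    using le_trans[OF _ cd(6)] ab c' d' x by (simp add: x_def)
  then show ?thesis
    by (rule belowI[rotated -1]) (use ab c' d' x in simp_all)
qed

lemma sim_iff: "g \<simeq> h \<longleftrightarrow> g \<lesssim> h \<and> h \<lesssim> g"
  unfolding sim_def using below_arrows by blast

lemma sim_refl: "g \<in> arrows G \<Longrightarrow> g \<simeq> g"
  by (simp add: sim_iff below_refl)

lemma sim_sym: "g \<simeq> h \<Longrightarrow> h \<simeq> g"
  by (simp add: sim_iff)

lemma sim_trans: "g \<simeq> h \<Longrightarrow> h \<simeq> k \<Longrightarrow> g \<simeq> k"
  using below_trans by (auto simp: sim_iff)

lemma sim_arrows: "g \<simeq> h \<Longrightarrow> g \<in> arrows G \<and> h \<in> arrows G"
  by (simp add: sim_def)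

lemma below_ginv:
  assumes "g \<lesssim> h"
  shows "ginv G g \<lesssim> ginv G h"
proof -
  obtain a b where ab: "a \<in> A" "b \<in> A" "g \<in> arrows G" "h \<in> arrows G"
    "gran G a = gdom G g" "gran G g = gdom G b" "a \<bullet> (g \<bullet> b) \<sqsubseteq> h"
    using assms by (rule belowE)
  have "ginv G b \<bullet> (ginv G g \<bullet> ginv G a) \<sqsubseteq> ginv G h"
    using OG1[OF ab(7)] ab by simp
  then show ?thesis
    by (rule belowI[rotated -1]) (use ab in simp_all)
qed

lemma below_gdom:
  assumes "g \<lesssim> h"
  shows "gdom G g \<lesssim> gdom G h"
proof -
  obtain a b where ab: "a \<in> A" "b \<in> A" "g \<in> arrows G" "h \<in> arrows G"
    "gran G a = gdom G g" "gran G g = gdom G b" "a \<bullet> (g \<bullet> b) \<sqsubseteq> h"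
    using assms by (rule belowE)
  have "a \<bullet> (gdom G g \<bullet> ginv G a) = gdom G a"
    using ab gdom_mul_self[of "ginv G a"] by simp
  moreover have "gdom G a \<sqsubseteq> gdom G h"
    using gdom_mono[OF ab(7)] ab by simp
  ultimately have "a \<bullet> (gdom G g \<bullet> ginv G a) \<sqsubseteq> gdom G h" by simp
  then show ?thesis
    by (rule belowI[rotated -1]) (use ab in simp_all)
qed

lemma below_gran: "g \<lesssim> h \<Longrightarrow> gran G g \<lesssim> gran G h"
  using below_gdom[OF below_ginv, of g h] below_arrows[of g h] by simp

lemma sim_ginv: "g \<simeq> h \<Longrightarrow> ginv G g \<simeq> ginv G h"
  by (simp add: sim_iff below_ginv)

lemma sim_gdom: "g \<simeq> h \<Longrightarrow> gdom G g \<simeq> gdom G h"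
  by (simp add: sim_iff below_gdom)

lemma sim_gran: "g \<simeq> h \<Longrightarrow> gran G g \<simeq> gran G h"
  by (simp add: sim_iff below_gran)

text \<open>Between identities the relation \<open>\<lesssim>\<close> amounts to one half of a nexus: in \<open>a e b \<le> f\<close> the arrow \<open>a\<close>
  has range \<open>e\<close> and its domain is the domain of \<open>a e b\<close>.\<close>

lemma below_identityE:
  assumes "e \<lesssim> f" "e \<in> identities G" "f \<in> identities G"
  obtains a where "a \<in> A" "gran G a = e" "gdom G a \<sqsubseteq> f"
proof -
  obtain a b where ab: "a \<in> A" "b \<in> A" "e \<in> arrows G"
    "gran G a = gdom G e" "gran G e = gdom G b" "a \<bullet> (e \<bullet> b) \<sqsubseteq> f"
    using assms(1) by (rule belowE)
  show ?thesis
    using that[of a] gdom_mono[OF ab(6)] ab assms by simp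
qed

lemma sim_mul_left:
  assumes "a \<in> A" "g \<in> arrows G" "gran G a = gdom G g"
  shows "a \<bullet> g \<simeq> g"
proof -
  have "ginv G a \<bullet> ((a \<bullet> g) \<bullet> gran G g) \<sqsubseteq> g"
    using assms le_refl by simp
  then have "a \<bullet> g \<lesssim> g"
    by (rule belowI[rotated -1]) (use assms in simp_all)
  moreover have "a \<bullet> (g \<bullet> gran G g) \<sqsubseteq> a \<bullet> g"
    using assms le_refl by simp
  then have "g \<lesssim> a \<bullet> g"
    by (rule belowI[rotated -1]) (use assms in simp_all)
  ultimately show ?thesis by (simp add: sim_iff)
qed

lemma sim_mul_right:
  assumes "a \<in> A" "g \<in> arrows G" "gran G g = gdom G a"
  shows "g \<bullet> a \<simeq> g"
  using sim_ginv[OF sim_mul_left[of "ginv G a" "ginv G g"]] assms by simp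

text \<open>The domain relation supplies \<open>a\<close> in \<open>A\<close> from the domain of a restriction \<open>h'\<close> of \<open>h\<close> to the domain
  of \<open>k\<close>. Since \<open>h'\<close> and \<open>k\<close> lie below \<open>g\<close>, normality puts \<open>v = h'\<^sup>-\<^sup>1 a k\<close> in \<open>A\<close>, and
  \<open>a k v\<^sup>-\<^sup>1 = h' \<le> h\<close>.\<close>

lemma below_if_gdom_below:
  assumes "h \<sqsubseteq> g" "k \<sqsubseteq> g" "gdom G k \<lesssim> gdom G h"
  shows "k \<lesssim> h"
proof -
  have arr: "h \<in> arrows G" "k \<in> arrows G" using le_arrows assms by blast+
  obtain a where a: "a \<in> A" "gran G a = gdom G k" "gdom G a \<sqsubseteq> gdom G h"
    using below_identityE[OF assms(3)] arr by auto
  define h' where "h' = restriction G (gdom G a) h"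
  have h': "h' \<in> arrows G" "gdom G h' = gdom G a" "h' \<sqsubseteq> h"
    using restriction arr a unfolding h'_def by simp_all
  define v where "v = ginv G h' \<bullet> (a \<bullet> k)"
  have v: "v \<in> A"
    unfolding v_def
    using A_conjugate[OF a(1) le_trans[OF h'(3) assms(1)] assms(2)] h' a by simp
  have "a \<bullet> (k \<bullet> ginv G v) = h'"
    using h' a arr by (simp add: v_def)
  then have "a \<bullet> (k \<bullet> ginv G v) \<sqsubseteq> h" using h' by simp
  moreover have "gdom G (ginv G v) = gran G k" using h' a arr by (simp add: v_def)
  ultimately show ?thesis
    using belowI[of a "ginv G v" k h] a v arr by simp
qed

lemma sim_if_gdom_sim: "\<lbrakk>h \<sqsubseteq> g; k \<sqsubseteq> g; gdom G h \<simeq> gdom G k\<rbrakk> \<Longrightarrow> h \<simeq> k"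
  using below_if_gdom_below by (simp add: sim_iff)

lemma sim_if_gran_sim:
  assumes "h \<sqsubseteq> g" "k \<sqsubseteq> g" "gran G h \<simeq> gran G k"
  shows "h \<simeq> k"
proof -
  have arr: "h \<in> arrows G" "k \<in> arrows G" using le_arrows assms by blast+
  have "ginv G h \<simeq> ginv G k"
    using sim_if_gdom_sim[OF OG1[OF assms(1)] OG1[OF assms(2)]] assms(3) arr by simp
  from sim_ginv[OF this] show ?thesis using arr by simp
qed

text \<open>With \<open>g\<^sub>1 = a g b \<le> g'\<close> and \<open>h\<^sub>1 = c h d \<le> h'\<close>, the arrow \<open>u = b\<^sup>-\<^sup>1 c\<^sup>-\<^sup>1\<close> of \<open>A\<close> links the range of \<open>g\<^sub>1\<close> to
  the domain of \<open>h\<^sub>1\<close>, and \<open>g h = a\<^sup>-\<^sup>1 g\<^sub>1 u h\<^sub>1 d\<^sup>-\<^sup>1\<close>. Let \<open>k\<close> be the restriction of \<open>h'\<close> to the range of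
  \<open>g\<^sub>1\<close>. Both \<open>k\<close> and \<open>h\<^sub>1\<close> lie below \<open>h'\<close>, so \<open>u\<close> can be moved across: \<open>u h\<^sub>1 = k v\<close> with \<open>v\<close> in \<open>A\<close>.
  Hence \<open>a (g h) (d v\<^sup>-\<^sup>1) = g\<^sub>1 k \<le> g' h'\<close>.\<close>

lemma below_mul_mono:
  assumes "g \<lesssim> g'" "h \<lesssim> h'" "gran G g = gdom G h" "gran G g' = gdom G h'"
  shows "g \<bullet> h \<lesssim> g' \<bullet> h'"
proof -
  obtain a b where ab: "a \<in> A" "b \<in> A" "g \<in> arrows G" "g' \<in> arrows G"
    "gran G a = gdom G g" "gran G g = gdom G b" "a \<bullet> (g \<bullet> b) \<sqsubseteq> g'"
    using assms(1) by (rule belowE)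
  obtain c d where cd: "c \<in> A" "d \<in> A" "h \<in> arrows G" "h' \<in> arrows G"
    "gran G c = gdom G h" "gran G h = gdom G d" "c \<bullet> (h \<bullet> d) \<sqsubseteq> h'"
    using assms(2) by (rule belowE)
  have db: "gdom G b = gdom G h" using ab assms by simp
  define u where "u = ginv G b \<bullet> ginv G c"
  have u: "u \<in> A" "gdom G u = gran G b" "gran G u = gdom G c"
    using ab cd db by (simp_all add: u_def)
  define k where "k = restriction G (gran G b) h'"
  have "gran G b \<sqsubseteq> gdom G h'"
    using gran_mono[OF ab(7)] ab assms(4) by simp
  then have k: "k \<in> arrows G" "gdom G k = gran G b" "k \<sqsubseteq> h'"
    using restriction ab(2) cd(4) unfolding k_def by simp_all
  define v where "v = ginv G k \<bullet> (u \<bullet> (c \<bullet> (h \<bullet> d)))"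
  have v: "v \<in> A"
    unfolding v_def by (rule A_conjugate[OF u(1) k(3) cd(7)]) (use u k cd in simp_all)
  have v_eq: "ginv G v = ginv G d \<bullet> (ginv G h \<bullet> (b \<bullet> k))"
    unfolding v_def u_def using ab cd k db by simp
  have dv: "gdom G (ginv G v) = gran G d"
    unfolding v_eq using ab cd k db by simp
  have "a \<bullet> ((g \<bullet> h) \<bullet> (d \<bullet> ginv G v)) = (a \<bullet> (g \<bullet> b)) \<bullet> k"
    unfolding v_eq using ab cd k db by simp
  also have "\<dots> \<sqsubseteq> g' \<bullet> h'"
    by (rule mul_mono[OF ab(7) k(3)]) (use ab k assms in simp_all)
  finally show ?thesis
    by (rule belowI[rotated -1]) (use ab cd v dv assms db in simp_all)
qed

lemma sim_mul:
  "\<lbrakk>g \<simeq> g'; h \<simeq> h'; gran G g = gdom G h; gran G g' = gdom G h'\<rbrakk> \<Longrightarrow> g \<bullet> h \<simeq> g' \<bullet> h'"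
  by (simp add: sim_iff below_mul_mono)

text \<open>The left part of the product \<open>(g|aa\<^sup>-\<^sup>1) a h\<close> that defines the composition of classes is again a
  representative of the class of \<open>g\<close>, now with the range of \<open>a\<close> as its range. One half of
  a nexus is \<open>a\<close>; the other half enters through the equivalence of the two ranges.\<close>

lemma corestriction_mul_sim:
  assumes "g \<in> arrows G" "a \<in> A" "gdom G a \<sqsubseteq> gran G g" "gran G a \<simeq> gran G g"
  shows "corestriction G g (gdom G a) \<bullet> a \<simeq> g"
proof -
  define c where "c = corestriction G g (gdom G a)"
  have c: "c \<in> arrows G" "gran G c = gdom G a" "c \<sqsubseteq> g"
    using corestriction assms unfolding c_def by simp_all
  have "a \<simeq> gran G a"
    using sim_mul_left[of a "gran G a"] assms(2) by simp
  then have "gdom G a \<simeq> gran G a"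
    using sim_gdom[of a "gran G a"] assms(2) by simp
  then have "gran G c \<simeq> gran G g" using assms(4) sim_trans c by simp
  then have "c \<simeq> g"
    using sim_if_gran_sim[OF c(3) le_refl[OF assms(1)]] by blast
  moreover have "c \<bullet> a \<simeq> c" using sim_mul_right assms(2) c by simp
  ultimately show ?thesis unfolding c_def using sim_trans by blast
qed

lemma lift_gran:
  assumes "g \<in> arrows G" "f \<in> identities G" "f \<simeq> gran G g"
  obtains g' where "g' \<simeq> g" "gran G g' = f"
proof -
  obtain a where a: "a \<in> A" "gran G a = f" "gdom G a \<sqsubseteq> gran G g"
    using below_identityE[of f "gran G g"] assms by (auto simp: sim_iff)
  note c = corestriction[OF assms(1) gdom_identity[OF A_arrow[OF a(1)]] a(3)]
  show ?thesis
    by (rule that[OF corestriction_mul_sim[OF assms(1) a(1) a(3)]]) (use a assms c in simp_all)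
qed

text \<open>The lifting property behind star-surjectivity of the quotient map.\<close>

lemma lift_gdom:
  assumes "g \<in> arrows G" "f \<in> identities G" "f \<simeq> gdom G g"
  obtains g' where "g' \<simeq> g" "gdom G g' = f"
proof -
  obtain k where k: "k \<simeq> ginv G g" "gran G k = f"
    using lift_gran[of "ginv G g" f] assms by auto
  then show ?thesis
    using that[of "ginv G k"] sim_ginv[OF k(1)] sim_arrows[OF k(1)] assms(1) by simp
qed


section \<open>Composition of classes\<close>

lemma equiv_sim: "equiv (arrows G) (sim G A)"
proof (rule equivI)
  show "sim G A \<subseteq> arrows G \<times> arrows G" using sim_arrows by auto
  show "refl_on (arrows G) (sim G A)" using sim_refl by (auto simp: refl_on_def)
  show "sym (sim G A)" using sim_sym by (auto simp: sym_def)
  show "trans (sim G A)" using sim_trans by (auto simp: trans_def)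
qed

lemma cls_eq_iff: "\<lbrakk>g \<in> arrows G; h \<in> arrows G\<rbrakk> \<Longrightarrow> cls g = cls h \<longleftrightarrow> g \<simeq> h"
  unfolding quotient_map_def using eq_equiv_class_iff[OF equiv_sim] by blast

lemma cls_eqI: "g \<simeq> h \<Longrightarrow> cls g = cls h"
  unfolding quotient_map_def using equiv_class_eq[OF equiv_sim] by blast

lemma mem_cls_iff: "h \<in> cls g \<longleftrightarrow> h \<simeq> g"
  unfolding quotient_map_def using sim_sym by blast

lemma classes_eq: "arrows G // sim G A = cls ` arrows G"
  unfolding quotient_def quotient_map_def by blast

text \<open>Existence in the description of the product is witnessed by \<open>g\<close> and \<open>h\<close> themselves with a trivial
  nexus. Uniqueness holds because any other choice of representatives and nexus yields a product
  of an arrow equivalent to \<open>g\<close> and an arrow equivalent to \<open>h\<close>.\<close>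

lemma quotient_comp_cls:
  assumes gh: "g \<in> arrows G" "h \<in> arrows G" "gran G g = gdom G h"
  shows "quotient_comp G A (cls g) (cls h) = Some (cls (g \<bullet> h))"
proof -
  let ?P = "\<lambda>Z. \<exists>k \<in> cls g. \<exists>l \<in> cls h. \<exists>a p x. nexus G A (gran G k) (gdom G l) a p \<and>
             pcomp3 G (corestriction G k (gdom G a)) a l = Some x \<and> Z = cls x"
  have "?P (cls (g \<bullet> h))"
  proof (intro bexI exI conjI)
    let ?e = "gdom G h"
    (* The range of g is already ?e, so corestricting to ?e changes nothing. *)
    have eq: "corestriction G g ?e = g"
    proof -
      have e: "?e \<in> identities G" "?e \<sqsubseteq> gdom G (ginv G g)" using gh le_refl by simp_all
      have "restriction G ?e (ginv G g) = ginv G g"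
        unfolding restriction_def
        by (rule the1_equality[OF OG3[OF _ e]]) (use gh le_refl in simp_all)
      then show ?thesis using gh by (simp add: corestriction_def)
    qed
    show "nexus G A (gran G g) (gdom G h) ?e ?e"
      using gh le_refl by (simp add: nexus_def)
    show "pcomp3 G (corestriction G g (gdom G ?e)) ?e h = Some (g \<bullet> h)"
      using gh eq by (simp add: pcomp3_Some_iff)
  qed (use gh in \<open>simp_all add: mem_cls_iff sim_refl\<close>)
  moreover have "Z = cls (g \<bullet> h)" if Z: "?P Z" for Z
  proof -
    obtain k l a p x where kl: "k \<in> cls g" "l \<in> cls h"
      and n: "nexus G A (gran G k) (gdom G l) a p"
      and x: "pcomp3 G (corestriction G k (gdom G a)) a l = Some x" and Zx: "Z = cls x"
      using Z by blast
    have k: "k \<simeq> g" and l: "l \<simeq> h" using kl by (simp_all add: mem_cls_iff)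
    define c where "c = corestriction G k (gdom G a)"
    have a: "a \<in> A" "gdom G a \<sqsubseteq> gran G k" "gran G a = gdom G l"
      using n by (simp_all add: nexus_def)
    have c: "c \<in> arrows G" "l \<in> arrows G" "gran G c = gdom G a" "x = c \<bullet> (a \<bullet> l)"
      using x unfolding pcomp3_Some_iff c_def by simp_all
    have "gran G a \<simeq> gran G g"
      using sim_gdom[OF l] a(3) gh(3) by simp
    then have "gran G a \<simeq> gran G k"
      using sim_trans sim_sym[OF sim_gran[OF k]] by blast
    then have "c \<bullet> a \<simeq> k"
      unfolding c_def using corestriction_mul_sim a k sim_arrows by blast
    then have "(c \<bullet> a) \<bullet> l \<simeq> g \<bullet> h"
      by (intro sim_mul[OF sim_trans[OF _ k] l]) (use a c gh in simp_all)
    then show ?thesis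
      unfolding Zx using cls_eqI a c by simp
  qed
  ultimately have the: "(THE Z. ?P Z) = cls (g \<bullet> h)"
    by (rule the_equality)
  have "\<exists>k \<in> cls g. \<exists>l \<in> cls h. gran G k \<simeq> gdom G l"
    using gh sim_refl[of "gdom G h"] sim_refl by (metis gdom_arrow mem_cls_iff)
  then show ?thesis
    unfolding quotient_comp_def classes_eq using gh the by auto
qed

text \<open>Every defined product of classes is computed by composable representatives: a representative of
  the left class is lifted so that its range is the domain of one of the right class.\<close>

lemma quotient_comp_SomeE:
  assumes "quotient_comp G A X Y = Some Z"
  obtains g h where "g \<in> arrows G" "h \<in> arrows G" "gran G g = gdom G h"
    "X = cls g" "Y = cls h" "Z = cls (g \<bullet> h)"
proof -
  obtain k l where "X \<in> cls ` arrows G" "Y \<in> cls ` arrows G" "k \<in> X" "l \<in> Y" "gran G k \<simeq> gdom G l"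
    using assms unfolding quotient_comp_def classes_eq by (auto split: if_splits)
  then have kl: "X = cls k" "Y = cls l" "k \<in> arrows G" "l \<in> arrows G" "gran G k \<simeq> gdom G l"
    using cls_eqI sim_sym sim_arrows by (auto simp: mem_cls_iff)
  obtain g where g: "g \<simeq> k" "gran G g = gdom G l"
    using lift_gran[OF kl(3) _ sim_sym[OF kl(5)]] kl(4) by auto
  have "quotient_comp G A (cls g) (cls l) = Some (cls (g \<bullet> l))"
    using quotient_comp_cls g kl(4) sim_arrows by blast
  then show ?thesis
    using that[of g l] g kl assms cls_eqI[OF g(1)] sim_arrows by auto
qed

lemma quotient_comp_representative:
  assumes "quotient_comp G A (cls g) (cls h) = Some Z" "g \<in> arrows G" "h \<in> arrows G"
  shows "gran G g \<simeq> gdom G h"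
proof -
  obtain k l where kl: "k \<in> arrows G" "l \<in> arrows G" "gran G k = gdom G l"
      "cls g = cls k" "cls h = cls l"
    using assms(1) by (rule quotient_comp_SomeE)
  have "g \<simeq> k" "l \<simeq> h" using kl assms cls_eq_iff sim_sym by blast+
  then have "gran G g \<simeq> gran G k" "gdom G l \<simeq> gdom G h" using sim_gran sim_gdom by blast+
  then show ?thesis using sim_trans kl(3) by simp
qed

lemma quotient_simps [simp]:
  "arrows (quotient_groupoid G A) = cls ` arrows G"
  "pcomp (quotient_groupoid G A) = quotient_comp G A"
  by (simp_all add: quotient_groupoid_def classes_eq)

lemma quotient_le_cls:
  assumes "g \<in> arrows G" "h \<in> arrows G"
  shows "le (quotient_groupoid G A) (cls g) (cls h) \<longleftrightarrow> g \<lesssim> h"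
proof
  assume "le (quotient_groupoid G A) (cls g) (cls h)"
  then obtain k l where "k \<simeq> g" "l \<simeq> h" "k \<lesssim> l"
    by (auto simp: quotient_groupoid_def mem_cls_iff)
  then show "g \<lesssim> h" using below_trans unfolding sim_iff by blast
next
  assume "g \<lesssim> h"
  then show "le (quotient_groupoid G A) (cls g) (cls h)"
    using assms mem_cls_iff sim_refl unfolding quotient_groupoid_def classes_eq
    by (simp, blast)
qed

lemma quotient_leE:
  assumes "le (quotient_groupoid G A) X Y"
  obtains g h where "g \<in> arrows G" "h \<in> arrows G" "X = cls g" "Y = cls h" "g \<lesssim> h"
proof -
  have "X \<in> cls ` arrows G" "Y \<in> cls ` arrows G"
    using assms by (simp_all add: quotient_groupoid_def classes_eq)
  then show ?thesis using that assms quotient_le_cls by blast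
qed

text \<open>If \<open>[e][h]\<close> is defined then \<open>e\<close> is equivalent to the domain of \<open>h\<close>, so the product can be computed
  as the domain of \<open>h\<close> times \<open>h\<close>.\<close>

lemma cls_identity:
  assumes e: "e \<in> identities G"
  shows "cls e \<in> identities (quotient_groupoid G A)"
proof -
  have "Z = Y" if Z: "quotient_comp G A (cls e) Y = Some Z" for Y Z
  proof -
    obtain h where h: "h \<in> arrows G" "Y = cls h" using Z by (rule quotient_comp_SomeE)
    then have "e \<simeq> gdom G h"
      using quotient_comp_representative[of e h Z] Z e identity_in_arrows by simp
    then have "cls e = cls (gdom G h)" by (rule cls_eqI)
    then show ?thesis
      using Z quotient_comp_cls[of "gdom G h" h] h by simp
  qed
  moreover have "Z = Y" if Z: "quotient_comp G A Y (cls e) = Some Z" for Y Z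
  proof -
    obtain h where h: "h \<in> arrows G" "Y = cls h" using Z by (rule quotient_comp_SomeE)
    then have "gran G h \<simeq> e"
      using quotient_comp_representative[of h e Z] Z e identity_in_arrows by simp
    then have "cls e = cls (gran G h)" using cls_eqI by simp
    then show ?thesis
      using Z quotient_comp_cls[of h "gran G h"] h by simp
  qed
  moreover have "cls e \<in> cls ` arrows G"
    using identity_in_arrows[OF e] by (rule imageI)
  ultimately show ?thesis
    unfolding identities_def mem_Collect_eq quotient_simps by blast
qed

text \<open>As soon as one bracketing is defined, the three classes have representatives that compose in a
  row: the first two are composable, and the third is lifted to fit them (or symmetrically).\<close>

lemma quotient_assoc:
  "Option.bind (quotient_comp G A X Y) (\<lambda>U. quotient_comp G A U Z) =
   Option.bind (quotient_comp G A Y Z) (\<lambda>V. quotient_comp G A X V)" (is "?L = ?R")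
proof -
  have both: "?L = Some (cls (g \<bullet> (h \<bullet> k))) \<and> ?R = Some (cls (g \<bullet> (h \<bullet> k)))"
    if "X = cls g" "Y = cls h" "Z = cls k" "g \<in> arrows G" "h \<in> arrows G" "k \<in> arrows G"
      "gran G g = gdom G h" "gran G h = gdom G k" for g h k
    using that quotient_comp_cls by simp
  show ?thesis
  proof (cases "?L = None \<and> ?R = None")
    case False
    then consider (L) W where "?L = Some W" | (R) W where "?R = Some W" by auto
    then show ?thesis
    proof cases
      case L
      then obtain U where U: "quotient_comp G A X Y = Some U" "quotient_comp G A U Z = Some W"
        by (auto simp: bind_eq_Some_conv)
      obtain g h where gh: "g \<in> arrows G" "h \<in> arrows G" "gran G g = gdom G h"
        "X = cls g" "Y = cls h" "U = cls (g \<bullet> h)" using U(1) by (rule quotient_comp_SomeE)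
      obtain l where l: "l \<in> arrows G" "Z = cls l" using U(2) by (rule quotient_comp_SomeE)
      have "gran G h \<simeq> gdom G l"
        using quotient_comp_representative[of "g \<bullet> h" l W] U(2) gh l by simp
      then obtain k where k: "k \<simeq> l" "gdom G k = gran G h"
        using lift_gdom[of l "gran G h"] gh l by auto
      have "Z = cls k" using cls_eqI[OF k(1)] l by simp
      from both[OF gh(4,5) this gh(1,2) _ gh(3)] show ?thesis
        using k sim_arrows[OF k(1)] by simp
    next
      case R
      then obtain V where V: "quotient_comp G A Y Z = Some V" "quotient_comp G A X V = Some W"
        by (auto simp: bind_eq_Some_conv)
      obtain h k where hk: "h \<in> arrows G" "k \<in> arrows G" "gran G h = gdom G k"
        "Y = cls h" "Z = cls k" "V = cls (h \<bullet> k)" using V(1) by (rule quotient_comp_SomeE)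
      obtain l where l: "l \<in> arrows G" "X = cls l" using V(2) by (rule quotient_comp_SomeE)
      have "gdom G h \<simeq> gran G l"
        using quotient_comp_representative[of l "h \<bullet> k" W] V(2) hk l sim_sym by simp
      then obtain g where g: "g \<simeq> l" "gran G g = gdom G h"
        using lift_gran[of l "gdom G h"] hk l by auto
      have "X = cls g" using cls_eqI[OF g(1)] l by simp
      from both[OF this hk(4,5) _ hk(1,2) g(2) hk(3)] show ?thesis
        using sim_arrows[OF g(1)] by simp
    qed
  qed simp
qed

lemma quotient_comp_defined:
  assumes XY: "quotient_comp G A X Y = Some U" and YZ: "quotient_comp G A Y Z = Some V"
  shows "quotient_comp G A U Z \<noteq> None"
proof -
  obtain g h where gh: "g \<in> arrows G" "h \<in> arrows G" "gran G g = gdom G h"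
    "X = cls g" "Y = cls h" "U = cls (g \<bullet> h)" using XY by (rule quotient_comp_SomeE)
  obtain l where l: "l \<in> arrows G" "Z = cls l" using YZ by (rule quotient_comp_SomeE)
  have "gran G h \<simeq> gdom G l"
    using quotient_comp_representative[of h l V] YZ gh l by simp
  then obtain k where k: "k \<simeq> l" "gdom G k = gran G h"
    using lift_gdom[of l "gran G h"] gh l by auto
  have "Z = cls k" using cls_eqI[OF k(1)] l by simp
  then show ?thesis
    using quotient_comp_cls[of "g \<bullet> h" k] gh k sim_arrows[OF k(1)] by simp
qed


section \<open>The quotient as an ordered groupoid\<close>

lemma quotient_is_groupoid: "groupoid (quotient_groupoid G A)"
proof
  fix X Y Z
  assume "pcomp (quotient_groupoid G A) X Y = Some Z"
  then obtain g h where "g \<in> arrows G" "h \<in> arrows G" "gran G g = gdom G h"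
    "X = cls g" "Y = cls h" "Z = cls (g \<bullet> h)"
    by (auto elim: quotient_comp_SomeE)
  then show "X \<in> arrows (quotient_groupoid G A) \<and> Y \<in> arrows (quotient_groupoid G A) \<and>
    Z \<in> arrows (quotient_groupoid G A)" by simp
next
  fix X Y Z
  show "Option.bind (pcomp (quotient_groupoid G A) X Y) (\<lambda>U. pcomp (quotient_groupoid G A) U Z) =
    Option.bind (pcomp (quotient_groupoid G A) Y Z) (pcomp (quotient_groupoid G A) X)"
    using quotient_assoc by simp
next
  fix X Y Z
  assume "pcomp (quotient_groupoid G A) X Y \<noteq> None" "pcomp (quotient_groupoid G A) Y Z \<noteq> None"
  then show "pcomp3 (quotient_groupoid G A) X Y Z \<noteq> None"
    using quotient_comp_defined by (fastforce simp: pcomp3_def)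
next
  fix X
  assume "X \<in> arrows (quotient_groupoid G A)"
  then obtain g where g: "g \<in> arrows G" "X = cls g" by auto
  show "\<exists>E\<in>identities (quotient_groupoid G A). pcomp (quotient_groupoid G A) E X \<noteq> None"
    using cls_identity[of "gdom G g"] quotient_comp_cls[of "gdom G g" g] g by auto
  show "\<exists>F\<in>identities (quotient_groupoid G A). pcomp (quotient_groupoid G A) X F \<noteq> None"
    using cls_identity[of "gran G g"] quotient_comp_cls[of g "gran G g"] g by auto
  show "\<exists>Y\<in>arrows (quotient_groupoid G A). \<exists>E\<in>identities (quotient_groupoid G A).
    \<exists>F\<in>identities (quotient_groupoid G A). pcomp (quotient_groupoid G A) X Y = Some E \<and>
      pcomp (quotient_groupoid G A) Y X = Some F"
  proof (intro bexI conjI)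
    show "pcomp (quotient_groupoid G A) X (cls (ginv G g)) = Some (cls (gdom G g))"
      using quotient_comp_cls[of g "ginv G g"] g by simp
    show "pcomp (quotient_groupoid G A) (cls (ginv G g)) X = Some (cls (gran G g))"
      using quotient_comp_cls[of "ginv G g" g] g by simp
  qed (use g cls_identity in simp_all)
qed

sublocale quotient: groupoid "quotient_groupoid G A"
  by (rule quotient_is_groupoid)

lemma quotient_ginv_gdom:
  assumes g: "g \<in> arrows G"
  shows "ginv (quotient_groupoid G A) (cls g) = cls (ginv G g)"
    and "gdom (quotient_groupoid G A) (cls g) = cls (gdom G g)"
proof -
  have inverse: "quotient_comp G A (cls g) (cls (ginv G g)) = Some (cls (gdom G g))"
    "quotient_comp G A (cls (ginv G g)) (cls g) = Some (cls (gran G g))"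
    using quotient_comp_cls[of g "ginv G g"] quotient_comp_cls[of "ginv G g" g] g by simp_all
  show "ginv (quotient_groupoid G A) (cls g) = cls (ginv G g)"
    by (rule quotient.ginv_eqI[of _ _ "cls (gdom G g)" "cls (gran G g)"])
      (simp_all add: inverse cls_identity g)
  show "gdom (quotient_groupoid G A) (cls g) = cls (gdom G g)"
    by (rule quotient.gdom_eqI[of _ "cls (ginv G g)" _ "cls (gran G g)"])
      (simp_all add: inverse cls_identity g)
qed

lemma quotient_identityE:
  assumes "E \<in> identities (quotient_groupoid G A)"
  obtains e where "e \<in> identities G" "E = cls e"
proof -
  obtain g where g: "g \<in> arrows G" "E = cls g"
    using quotient.identity_in_arrows[OF assms] by auto
  have "E = cls (gdom G g)"
    using quotient.gdom_of_identity[OF assms] quotient_ginv_gdom g by simp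
  then show ?thesis using that[OF gdom_identity[OF g(1)]] by blast
qed

text \<open>The identity \<open>f\<close> is equivalent to an identity \<open>e\<close> below the domain of \<open>g\<close>, to which \<open>g\<close> can be
  restricted in \<open>G\<close>. Conversely every class below that of \<open>g\<close> has a representative below \<open>g\<close>, and two arrows
  below \<open>g\<close> with equivalent domains are equivalent.\<close>

lemma quotient_restriction:
  assumes g: "g \<in> arrows G" and f: "f \<in> identities G" and fg: "f \<lesssim> gdom G g"
  shows "\<exists>!X. X \<in> cls ` arrows G \<and> gdom (quotient_groupoid G A) X = cls f \<and>
    le (quotient_groupoid G A) X (cls g)"
proof -
  have lift: "\<exists>h'. h' \<simeq> h \<and> h' \<sqsubseteq> g" if h: "h \<lesssim> g" for h
  proof -
    obtain a b where ab: "a \<in> A" "b \<in> A" "h \<in> arrows G"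
      "gran G a = gdom G h" "gran G h = gdom G b" "a \<bullet> (h \<bullet> b) \<sqsubseteq> g"
      using h by (rule belowE)
    have "a \<bullet> (h \<bullet> b) \<simeq> h \<bullet> b" "h \<bullet> b \<simeq> h"
      using sim_mul_left sim_mul_right ab by simp_all
    then show ?thesis using ab(6) sim_trans by blast
  qed
  obtain e where e: "e \<simeq> f" "e \<sqsubseteq> gdom G g" "e \<in> identities G"
  proof -
    obtain a where a: "a \<in> A" "gran G a = f" "gdom G a \<sqsubseteq> gdom G g"
      using below_identityE[OF fg f] g by auto
    have "gdom G (a \<bullet> f) \<simeq> gdom G f"
      using sim_gdom[OF sim_mul_left[of a f]] a f identity_in_arrows by simp
    then show ?thesis using that[of "gdom G a"] a f identity_in_arrows by simp
  qed
  note r = restriction[OF g e(3,2)]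
  show ?thesis
  proof (rule ex1I[of _ "cls (restriction G e g)"])
    show "cls (restriction G e g) \<in> cls ` arrows G \<and>
      gdom (quotient_groupoid G A) (cls (restriction G e g)) = cls f \<and>
      le (quotient_groupoid G A) (cls (restriction G e g)) (cls g)"
      using r e cls_eqI quotient_ginv_gdom quotient_le_cls below_if_le g by simp
  next
    fix X
    assume X: "X \<in> cls ` arrows G \<and> gdom (quotient_groupoid G A) X = cls f \<and>
      le (quotient_groupoid G A) X (cls g)"
    then obtain h where h: "h \<in> arrows G" "X = cls h" "cls (gdom G h) = cls f" "h \<lesssim> g"
      using quotient_ginv_gdom quotient_le_cls g by auto
    obtain h' where h': "h' \<simeq> h" "h' \<sqsubseteq> g" using lift h(4) by blast
    have "gdom G h \<simeq> f" using h cls_eq_iff f identity_in_arrows by simp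
    then have "gdom G h' \<simeq> gdom G (restriction G e g)"
      using sim_gdom[OF h'(1)] e(1) r(2) sim_trans sim_sym by metis
    then have "h' \<simeq> restriction G e g"
      using sim_if_gdom_sim h'(2) r(3) by blast
    then show "X = cls (restriction G e g)"
      using h(2) h'(1) cls_eqI by metis
  qed
qed

lemma quotient_is_ordered_groupoid: "ordered_groupoid (quotient_groupoid G A)"
proof
  let ?Q = "quotient_groupoid G A"
  show "partial_order_on (arrows ?Q) {(X, Y). le ?Q X Y}"
    unfolding partial_order_on_def preorder_on_def
  proof (intro conjI)
    show "{(X, Y). le ?Q X Y} \<subseteq> arrows ?Q \<times> arrows ?Q"
      by (auto elim!: quotient_leE)
    show "refl_on (arrows ?Q) {(X, Y). le ?Q X Y}"
      by (auto simp: refl_on_def quotient_le_cls below_refl)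
    show "trans {(X, Y). le ?Q X Y}"
    proof (rule transI, clarify)
      fix X Y Z
      assume XY: "le ?Q X Y" and YZ: "le ?Q Y Z"
      obtain g h where gh: "g \<in> arrows G" "h \<in> arrows G" "X = cls g" "Y = cls h" "g \<lesssim> h"
        using XY by (rule quotient_leE)
      obtain k where k: "k \<in> arrows G" "Z = cls k"
        using YZ by (rule quotient_leE)
      show "le ?Q X Z"
        using YZ gh k quotient_le_cls below_trans by metis
    qed
    show "antisym {(X, Y). le ?Q X Y}"
    proof (rule antisymI, clarify)
      fix X Y
      assume XY: "le ?Q X Y" and YX: "le ?Q Y X"
      obtain g h where gh: "g \<in> arrows G" "h \<in> arrows G" "X = cls g" "Y = cls h" "g \<lesssim> h"
        using XY by (rule quotient_leE)
      then show "X = Y" using YX quotient_le_cls cls_eqI sim_iff by metis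
    qed
  qed
next
  fix X Y
  assume "le (quotient_groupoid G A) X Y"
  then show "le (quotient_groupoid G A) (ginv (quotient_groupoid G A) X) (ginv (quotient_groupoid G A) Y)"
    by (rule quotient_leE) (simp add: quotient_ginv_gdom quotient_le_cls below_ginv)
next
  fix X X' Y Y' Z Z'
  assume le: "le (quotient_groupoid G A) X X'" "le (quotient_groupoid G A) Y Y'"
    and "pcomp (quotient_groupoid G A) X Y = Some Z" "pcomp (quotient_groupoid G A) X' Y' = Some Z'"
  then have Z: "quotient_comp G A X Y = Some Z" and Z': "quotient_comp G A X' Y' = Some Z'"
    by simp_all
  obtain g h where gh: "g \<in> arrows G" "h \<in> arrows G" "gran G g = gdom G h"
    "X = cls g" "Y = cls h" "Z = cls (g \<bullet> h)" using Z by (rule quotient_comp_SomeE)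
  obtain g' h' where gh': "g' \<in> arrows G" "h' \<in> arrows G" "gran G g' = gdom G h'"
    "X' = cls g'" "Y' = cls h'" "Z' = cls (g' \<bullet> h')" using Z' by (rule quotient_comp_SomeE)
  have "g \<bullet> h \<lesssim> g' \<bullet> h'"
    using below_mul_mono gh gh' le quotient_le_cls by simp
  then show "le (quotient_groupoid G A) Z Z'"
    using gh gh' quotient_le_cls by simp
next
  fix X F
  assume X: "X \<in> arrows (quotient_groupoid G A)" and F: "F \<in> identities (quotient_groupoid G A)"
    and le: "le (quotient_groupoid G A) F (gdom (quotient_groupoid G A) X)"
  obtain g where g: "g \<in> arrows G" "X = cls g" using X by auto
  obtain f where f: "f \<in> identities G" "F = cls f" using F by (rule quotient_identityE)
  have "f \<lesssim> gdom G g"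
    using le g f quotient_ginv_gdom quotient_le_cls identity_in_arrows by simp
  from quotient_restriction[OF g(1) f(1) this]
  show "\<exists>!Y. Y \<in> arrows (quotient_groupoid G A) \<and> gdom (quotient_groupoid G A) Y = F \<and>
    le (quotient_groupoid G A) Y X"
    using g f by simp
qed

lemma quotient_map_is_fibration: "fibration G (quotient_groupoid G A) cls"
proof (intro fibration.intro ordered_functor.intro)
  show "ordered_groupoid G" by (rule ordered_groupoid_axioms)
  show "ordered_groupoid (quotient_groupoid G A)" by (rule quotient_is_ordered_groupoid)
  show "ordered_functor_axioms G (quotient_groupoid G A) cls"
  proof
    fix g h k
    show "g \<in> arrows G \<Longrightarrow> cls g \<in> arrows (quotient_groupoid G A)" by simp
    show "g \<in> identities G \<Longrightarrow> cls g \<in> identities (quotient_groupoid G A)" by (rule cls_identity)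
    show "g \<cdot> h = Some k \<Longrightarrow> pcomp (quotient_groupoid G A) (cls g) (cls h) = Some (cls k)"
      by (simp add: comp_Some_iff quotient_comp_cls)
    show "g \<sqsubseteq> h \<Longrightarrow> le (quotient_groupoid G A) (cls g) (cls h)"
      using quotient_le_cls below_if_le le_arrows by blast
  qed
  show "fibration_axioms G (quotient_groupoid G A) cls"
  proof
    fix e
    assume e: "e \<in> identities G"
    have "X \<in> cls ` star G e" if X: "X \<in> star (quotient_groupoid G A) (cls e)" for X
    proof -
      obtain h where h: "h \<in> arrows G" "X = cls h" "cls (gdom G h) = cls e"
        using X quotient_ginv_gdom by (auto simp: star_def)
      then have "e \<simeq> gdom G h"
        using cls_eq_iff[of e "gdom G h"] e identity_in_arrows by simp
      then obtain g where g: "g \<simeq> h" "gdom G g = e"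
        using lift_gdom[OF h(1) e] by blast
      then show ?thesis
        using h(2) cls_eqI[OF g(1)] sim_arrows[OF g(1)] by (auto simp: star_def)
    qed
    then show "cls ` star G e = star (quotient_groupoid G A) (cls e)"
      using quotient_ginv_gdom by (auto simp: star_def)
  qed
qed

end


section \<open>The quotient fibration\<close>

theorem theorem3p14:
  fixes G :: "('a, 'm) ogpd_scheme" and A :: "'a set"
  assumes "ordered_groupoid G"
    and "normal_ordered_subgroupoid A G"
  shows "ordered_groupoid (quotient_groupoid G A) \<and>
         fibration G (quotient_groupoid G A) (quotient_map G A)"
proof -
  interpret normal_quotient G A
    using assms by (simp add: normal_quotient_def normal_quotient_axioms_def)
  show ?thesis
    using quotient_is_ordered_groupoid quotient_map_is_fibration by blast
qed

end
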